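(* Let $m,n$ be positive integers with $n>m\ge 10$, and let $T_m\in\{T_m'',T_m''',T_m^3\}$. Then $$r(T_m,T_n')=r(T_m,T_n^* )=\begin{cases}m+n-3&\text{if } m-1\mid n-3,\\ m+n-4&\text{if } m-1\nmid n-3 \text{ and } n\ge (m-3)^2+2.\end{cases}$$
   Context: All graphs are finite simple graphs. For graphs $G_1,G_2$, the Ramsey number $r(G_1,G_2)$ is the smallest positive integer $N$ such that for every graph $G$ on $N$ vertices, either $G$ contains a (not necessarily induced) subgraph isomorphic to $G_1$, or the complement $\overline{G}$ contains a subgraph isomorphic to $G_2$. $T_n'$ is the unique tree on $n$ vertices with maximum degree $n-2$. $T_n^*$ is the tree on $\{v_0,\ldots,v_{n-1}\}$ with edges $v_0v_1,\ldots,v_0v_{n-3},v_{n-3}v_{n-2},v_{n-2}v_{n-1}$. On vertex set $\{v_0,\ldots,v_{m-1}\}$: $T_m''$ has edges $v_0v_1,\ldots,v_0v_{m-4},v_1v_{m-3},v_1v_{m-2},v_2v_{m-1}$; $T_m'''$ has edges $v_0v_1,\ldots,v_0v_{m-4},v_1v_{m-3},v_2v_{m-2},v_3v_{m-1}$; $T_m^3$ has edges $v_0v_1,\ldots,v_0v_{m-4},v_{m-4}v_{m-3},v_{m-4}v_{m-2},v_{m-4}v_{m-1}$. *)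

theory Defs
  imports "HOL-Library.Ramsey"
begin

section \<open>Finite simple graphs\<close>

record 'a ugraph =
  verts :: "'a set"
  edges :: "'a set set"

definition simple_graph :: "'a ugraph \<Rightarrow> bool" where
  "simple_graph G \<longleftrightarrow> finite (verts G) \<and> edges G \<subseteq> nsets (verts G) 2"

definition complement :: "'a ugraph \<Rightarrow> 'a ugraph" where
  "complement G = \<lparr>verts = verts G, edges = nsets (verts G) 2 - edges G\<rparr>"

definition subgraph :: "'a ugraph \<Rightarrow> 'a ugraph \<Rightarrow> bool" where
  "subgraph H G \<longleftrightarrow> simple_graph H \<and> verts H \<subseteq> verts G \<and> edges H \<subseteq> edges G"

definition isomorphic :: "'a ugraph \<Rightarrow> 'b ugraph \<Rightarrow> bool" where
  "isomorphic G H \<longleftrightarrow>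
     (\<exists>f. bij_betw f (verts G) (verts H) \<and> edges H = (\<lambda>e. f ` e) ` edges G)"

definition contains_copy :: "'a ugraph \<Rightarrow> 'b ugraph \<Rightarrow> bool" where
  "contains_copy G H \<longleftrightarrow> (\<exists>S. subgraph S G \<and> isomorphic S H)"

text \<open>Host graphs have vertices in \<open>nat\<close>, which up to isomorphism covers every finite graph.
  By Ramsey's theorem the set of such \<open>N\<close> is nonempty whenever \<open>G1\<close> and \<open>G2\<close> are finite
  simple graphs, so the \<open>LEAST\<close> is attained.\<close>

definition ramsey_number :: "'a ugraph \<Rightarrow> 'b ugraph \<Rightarrow> nat" where
  "ramsey_number G1 G2 =
     (LEAST N. N > 0 \<and>
        (\<forall>G :: nat ugraph. simple_graph G \<and> card (verts G) = N \<longrightarrow>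
            contains_copy G G1 \<or> contains_copy (complement G) G2))"

section \<open>Trees and maximum degree\<close>

definition degree :: "'a ugraph \<Rightarrow> 'a \<Rightarrow> nat" where
  "degree G v = card {e \<in> edges G. v \<in> e}"

definition max_degree :: "'a ugraph \<Rightarrow> nat" where
  "max_degree G = Max (degree G ` verts G)"

definition connected_graph :: "'a ugraph \<Rightarrow> bool" where
  "connected_graph G \<longleftrightarrow> verts G \<noteq> {} \<and>
     (\<forall>u\<in>verts G. \<forall>v\<in>verts G. (u, v) \<in> {(x, y). {x, y} \<in> edges G}\<^sup>*)"

definition is_cycle :: "'a ugraph \<Rightarrow> 'a list \<Rightarrow> bool" where
  "is_cycle G vs \<longleftrightarrow> length vs \<ge> 3 \<and> distinct vs \<and>
     (\<forall>i<length vs. {vs ! i, vs ! (Suc i mod length vs)} \<in> edges G)"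

definition is_tree :: "'a ugraph \<Rightarrow> bool" where
  "is_tree G \<longleftrightarrow> simple_graph G \<and> connected_graph G \<and> (\<nexists>vs. is_cycle G vs)"

section \<open>The special trees\<close>

text \<open>\<open>is_T' n T\<close> says that \<open>T\<close> is (a copy of) the tree $T_n'$. For \<open>n \<ge> 4\<close> this determines
  \<open>T\<close> up to isomorphism: a star on \<open>n - 1\<close> vertices with one edge subdivided.\<close>

definition is_T' :: "nat \<Rightarrow> 'a ugraph \<Rightarrow> bool" where
  "is_T' n T \<longleftrightarrow> is_tree T \<and> card (verts T) = n \<and> max_degree T = n - 2"

text \<open>In the explicit trees below the vertex $v_i$ is the number \<open>i\<close>. The index subtractions on
  \<open>nat\<close> are meaningful for \<open>n \<ge> 4\<close> in \<open>T_star n\<close>, and for \<open>m \<ge> 6\<close>, \<open>m \<ge> 7\<close> and \<open>m \<ge> 5\<close> in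
  \<open>T_2 m\<close> ($T_m''$), \<open>T_3 m\<close> ($T_m'''$) and \<open>T_cube m\<close> ($T_m^3$) respectively.\<close>

definition T_star :: "nat \<Rightarrow> nat ugraph" where
  "T_star n = \<lparr>verts = {0..<n},
     edges = {{0, i} | i. i \<in> {1..n-3}} \<union> {{n-3, n-2}, {n-2, n-1}}\<rparr>"

definition T_2 :: "nat \<Rightarrow> nat ugraph" where
  "T_2 m = \<lparr>verts = {0..<m},
     edges = {{0, i} | i. i \<in> {1..m-4}} \<union> {{1, m-3}, {1, m-2}, {2, m-1}}\<rparr>"

definition T_3 :: "nat \<Rightarrow> nat ugraph" where
  "T_3 m = \<lparr>verts = {0..<m},
     edges = {{0, i} | i. i \<in> {1..m-4}} \<union> {{1, m-3}, {2, m-2}, {3, m-1}}\<rparr>"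

definition T_cube :: "nat \<Rightarrow> nat ugraph" where
  "T_cube m = \<lparr>verts = {0..<m},
     edges = {{0, i} | i. i \<in> {1..m-4}} \<union> {{m-4, m-3}, {m-4, m-2}, {m-4, m-1}}\<rparr>"

text \<open>The predicate \<open>is_T'\<close> is satisfiable.\<close>

lemma cycle_two_neighbours:
  assumes "is_cycle G vs" "x \<in> set vs"
  shows "\<exists>y z. y \<in> set vs \<and> z \<in> set vs \<and> y \<noteq> z \<and> {x, y} \<in> edges G \<and> {x, z} \<in> edges G"
proof -
  let ?l = "length vs"
  have l: "?l \<ge> 3" and d: "distinct vs"
    and e: "\<And>i. i < ?l \<Longrightarrow> {vs ! i, vs ! (Suc i mod ?l)} \<in> edges G"
    using assms(1) unfolding is_cycle_def by auto
  obtain i where i: "i < ?l" "x = vs ! i"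
    using assms(2) by (metis in_set_conv_nth)
  define j where "j = (if i = 0 then ?l - 1 else i - 1)"
  define k where "k = Suc i mod ?l"
  have j: "j < ?l" "Suc j mod ?l = i"
    using i l by (auto simp: j_def)
  have k: "k < ?l" unfolding k_def using i(1) by (intro mod_less_divisor) linarith
  have "j \<noteq> k"
  proof (cases "Suc i = ?l")
    case True
    then show ?thesis using l by (auto simp: j_def k_def)
  next
    case False
    then have "k = Suc i" using i by (simp add: k_def)
    then show ?thesis using l i by (auto simp: j_def)
  qed
  then have "vs ! j \<noteq> vs ! k" using d j k by (simp add: nth_eq_iff_index_eq)
  moreover have "{x, vs ! k} \<in> edges G" using e[OF i(1)] i(2) by (simp add: k_def)
  moreover have "{x, vs ! j} \<in> edges G"
    using e[OF j(1)] j(2) i(2) by (simp add: insert_commute)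
  ultimately show ?thesis using j k by (metis nth_mem)
qed

lemma is_T'_exists:
  assumes "n \<ge> 4"
  shows "is_T' n \<lparr>verts = {0..<n}, edges = {{0, i} | i. i \<in> {1..n-2}} \<union> {{1, n-1}}\<rparr>"
    (is "is_T' n ?T")
proof -
  have simp: "simple_graph ?T"
    using assms by (auto simp: simple_graph_def nsets_def card_insert_if)
  have adj: "{x, y} \<in> edges ?T \<longleftrightarrow>
      (x = 0 \<and> y \<in> {1..n-2}) \<or> (y = 0 \<and> x \<in> {1..n-2}) \<or>
      (x = 1 \<and> y = n-1) \<or> (x = n-1 \<and> y = 1)" for x y
    by (auto simp: doubleton_eq_iff)
  let ?R = "{(x, y). {x, y} \<in> edges ?T}"
  have sym: "sym ?R" by (auto simp: sym_def insert_commute)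
  have to0: "(v, 0) \<in> ?R\<^sup>*" if "v < n" for v
  proof -
    have 1: "(v, 0) \<in> ?R\<^sup>*" if "v \<le> n - 2" for v
    proof (cases "v = 0")
      case False
      then have "(v, 0) \<in> ?R" using that adj[of v 0] by auto
      then show ?thesis by blast
    qed simp
    show ?thesis
    proof (cases "v \<le> n - 2")
      case False
      then have "v = n - 1" using that by simp
      then have "(v, 1) \<in> ?R" using adj[of v 1] by auto
      moreover have "(1, 0) \<in> ?R\<^sup>*" using 1[of 1] assms by simp
      ultimately show ?thesis by (rule converse_rtrancl_into_rtrancl)
    qed (rule 1)
  qed
  have conn: "connected_graph ?T"
    unfolding connected_graph_def
  proof (intro conjI ballI)
    show "verts ?T \<noteq> {}" using assms by simp
    fix u v assume "u \<in> verts ?T" "v \<in> verts ?T"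
    then have "(u, 0) \<in> ?R\<^sup>*" "(0, v) \<in> ?R\<^sup>*"
      using to0 sym_rtrancl[OF sym] by (auto dest: symD)
    then show "(u, v) \<in> ?R\<^sup>*" by (rule rtrancl_trans)
  qed
  have acyc: "\<not> is_cycle ?T vs" for vs
  proof
    assume c: "is_cycle ?T vs"
    have "x \<in> {0, 1}" if x: "x \<in> set vs" for x
    proof -
      obtain y z where "y \<noteq> z" "{x, y} \<in> edges ?T" "{x, z} \<in> edges ?T"
        using cycle_two_neighbours[OF c x] by blast
      then show ?thesis using adj[of x y] adj[of x z] by auto
    qed
    then have "card (set vs) \<le> card {0, 1::nat}" by (intro card_mono) auto
    then show False using c by (auto simp: is_cycle_def distinct_card)
  qed
  have inc: "{e \<in> edges ?T. v \<in> e} = (\<lambda>w. {v, w}) ` {w. {v, w} \<in> edges ?T}" for v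
    by auto
  have deg: "degree ?T v = card {w. {v, w} \<in> edges ?T}" for v
    unfolding degree_def inc
    by (rule card_image) (auto simp: inj_on_def doubleton_eq_iff)
  have d0: "degree ?T 0 = n - 2"
  proof -
    have "{w. {0, w} \<in> edges ?T} = {1..n-2}"
      unfolding adj using assms by auto
    then show ?thesis unfolding deg by simp
  qed
  have dv: "degree ?T v \<le> n - 2" if "v \<noteq> 0" for v
  proof -
    have "\<exists>a b. {w. {v, w} \<in> edges ?T} \<subseteq> {a, b}"
      unfolding adj
      by (rule exI[of _ 0], rule exI[of _ "if v = 1 then n - 1 else 1"])
        (use that assms in \<open>auto split: if_splits\<close>)
    then obtain a b where "{w. {v, w} \<in> edges ?T} \<subseteq> {a, b}" by blast
    then have "card {w. {v, w} \<in> edges ?T} \<le> card {a, b}" by (rule card_mono[rotated]) simp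
    also have "\<dots> \<le> 2" by (simp add: card_insert_if)
    finally show ?thesis unfolding deg using assms by linarith
  qed
  have "max_degree ?T = n - 2"
    unfolding max_degree_def
  proof (rule Max_eqI)
    show "finite (degree ?T ` verts ?T)" by simp
    show "y \<le> n - 2" if y: "y \<in> degree ?T ` verts ?T" for y
    proof -
      obtain v where v: "y = degree ?T v" using y by blast
      show ?thesis
      proof (cases "v = 0")
        case True
        show ?thesis unfolding v True by (rule eq_refl) (rule d0)
      next
        case False
        then show ?thesis unfolding v by (rule dv)
      qed
    qed
    show "n - 2 \<in> degree ?T ` verts ?T"
      by (rule image_eqI[where x = 0], rule d0[symmetric]) (use assms in simp)
  qed
  then show ?thesis using simp conn acyc by (simp add: is_T'_def is_tree_def)
qed

end

theory Submission
  imports Defs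
begin

text \<open>Upper bound: a greedy embedding shows that a graph of minimum degree at least \<open>m - 2\<close>
  without a copy of \<open>T\<close> is a disjoint union of cliques on \<open>m - 1\<close> vertices. If all degrees in the
  complement \<open>H\<close> of \<open>G\<close> are at most \<open>n - 3\<close>, this applies to \<open>G\<close>, whose order or degrees exclude it.
  Otherwise let \<open>v\<close> have \<open>H\<close>-degree at least \<open>n - 2\<close>, with \<open>H\<close>-neighbourhood \<open>A\<close>. Since \<open>H\<close> has no
  near-star, \<open>G\<close> restricted to \<open>A\<close> is complete up to a matching (if the degree is larger than
  \<open>n - 2\<close>), or every vertex outside \<open>A\<close> is \<open>G\<close>-adjacent to all but at most one vertex of \<open>A\<close> (if it
  equals \<open>n - 2\<close>); both make room for \<open>T\<close>.

  Lower bound: disjoint unions of cliques on \<open>m - 1\<close> and \<open>m - 2\<close> vertices. Their existence on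
  \<open>m + n - 5\<close> vertices is the Frobenius condition \<open>m + n - 5 \<ge> (m - 2) (m - 3)\<close>, which is
  \<open>n \<ge> (m - 3)\<^sup>2 + 2\<close>.\<close>

section \<open>Copies and neighbourhoods\<close>

definition nbrs :: "'a ugraph \<Rightarrow> 'a \<Rightarrow> 'a set" where
  "nbrs G v = {w. {v, w} \<in> edges G}"

lemma nbrs_iff: "w \<in> nbrs G v \<longleftrightarrow> {v, w} \<in> edges G"
  by (simp add: nbrs_def)

lemma nbrs_sym: "w \<in> nbrs G v \<longleftrightarrow> v \<in> nbrs G w"
  by (simp add: nbrs_def insert_commute)

lemma simple_graph_edgeD:
  assumes "simple_graph G" "{a, b} \<in> edges G"
  shows "a \<in> verts G" "b \<in> verts G" "a \<noteq> b"
proof -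
  have "{a, b} \<in> nsets (verts G) 2" using assms unfolding simple_graph_def by blast
  then show "a \<in> verts G" "b \<in> verts G" "a \<noteq> b" by simp_all
qed

lemma simple_graph_edgeE:
  assumes "simple_graph G" "e \<in> edges G"
  obtains a b where "e = {a, b}" "a \<noteq> b" "a \<in> verts G" "b \<in> verts G"
proof -
  have "e \<in> nsets (verts G) 2" using assms by (auto simp: simple_graph_def)
  then show ?thesis using that by (auto simp: nsets_def card_2_iff)
qed

lemma nbrs_subset: "simple_graph G \<Longrightarrow> nbrs G v \<subseteq> verts G - {v}"
  using simple_graph_edgeD[of G v] by (auto simp: nbrs_def)

lemma finite_nbrs: "simple_graph G \<Longrightarrow> finite (nbrs G v)"
  by (meson finite_Diff finite_subset nbrs_subset simple_graph_def)

lemma simple_graph_complement: "simple_graph G \<Longrightarrow> simple_graph (complement G)"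
  by (auto simp: simple_graph_def complement_def)

lemma verts_complement [simp]: "verts (complement G) = verts G"
  by (simp add: complement_def)

lemma edges_complement_iff:
  "{a, b} \<in> edges (complement G) \<longleftrightarrow>
     a \<in> verts G \<and> b \<in> verts G \<and> a \<noteq> b \<and> {a, b} \<notin> edges G"
  by (auto simp: complement_def)

lemma nbrs_complement: "v \<in> verts G \<Longrightarrow> nbrs (complement G) v = verts G - {v} - nbrs G v"
  by (auto simp: nbrs_def edges_complement_iff)

lemma degree_eq_card_nbrs:
  assumes "simple_graph G"
  shows "degree G v = card (nbrs G v)"
proof -
  have inc: "{e \<in> edges G. v \<in> e} = (\<lambda>w. {v, w}) ` nbrs G v"
  proof (intro equalityI subsetI)
    fix e assume e: "e \<in> {e \<in> edges G. v \<in> e}"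
    then obtain a b where "e = {a, b}" using simple_graph_edgeE[OF assms, of e] by blast
    then obtain w where "e = {v, w}" using e by (auto simp: insert_commute)
    then show "e \<in> (\<lambda>w. {v, w}) ` nbrs G v" using e by (auto simp: nbrs_iff)
  qed (auto simp: nbrs_iff)
  show ?thesis
    unfolding degree_def inc
    by (rule card_image) (auto simp: inj_on_def doubleton_eq_iff)
qed

lemma contains_copyI:
  assumes H: "simple_graph H" and inj: "inj_on f (verts H)" and sub: "f ` verts H \<subseteq> verts G"
    and edges: "\<And>a b. {a, b} \<in> edges H \<Longrightarrow> {f a, f b} \<in> edges G"
  shows "contains_copy G H"
proof -
  define S where "S = \<lparr>verts = f ` verts H, edges = (\<lambda>e. f ` e) ` edges H\<rparr>"
  have eH: "e \<subseteq> verts H" "card e = 2" "finite e" if "e \<in> edges H" for e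
    using H that by (auto simp: simple_graph_def nsets_def)
  have "simple_graph S"
    unfolding simple_graph_def
  proof (intro conjI subsetI)
    show "finite (verts S)" using H by (simp add: S_def simple_graph_def)
    fix e' assume "e' \<in> edges S"
    then obtain e where e: "e \<in> edges H" "e' = f ` e" by (auto simp: S_def)
    have "card (f ` e) = 2"
      using eH[OF e(1)] inj by (metis card_image inj_on_subset)
    then show "e' \<in> nsets (verts S) 2"
      using eH[OF e(1)] e(2) by (auto simp: nsets_def S_def)
  qed
  moreover have "edges S \<subseteq> edges G"
  proof
    fix e' assume "e' \<in> edges S"
    then obtain e where e: "e \<in> edges H" "e' = f ` e" by (auto simp: S_def)
    obtain a b where "e = {a, b}" using simple_graph_edgeE[OF H e(1)] by metis
    then show "e' \<in> edges G" using e edges[of a b] by simp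
  qed
  moreover have "isomorphic S H"
    unfolding isomorphic_def
  proof (intro exI conjI)
    \<comment> \<open>\<open>isomorphic\<close> is read from the subgraph to \<open>H\<close>, so
      the witness is the inverse of the embedding \<open>f\<close>.\<close>
    show "bij_betw (inv_into (verts H) f) (verts S) (verts H)"
      using inj by (simp add: S_def bij_betw_inv_into inj_on_imp_bij_betw)
    have "inv_into (verts H) f ` f ` e = e" if "e \<in> edges H" for e
      using eH(1)[OF that] inj by (simp add: inv_into_image_cancel)
    then show "edges H = (\<lambda>e. inv_into (verts H) f ` e) ` edges S"
      by (simp add: S_def image_image)
  qed
  ultimately show ?thesis
    using sub unfolding contains_copy_def subgraph_def
    by (intro exI[of _ S]) (simp add: S_def)
qed

lemma contains_copyE:
  assumes "contains_copy G H"
  obtains f where "inj_on f (verts H)" "f ` verts H \<subseteq> verts G"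
    "\<And>a b. {a, b} \<in> edges H \<Longrightarrow> {f a, f b} \<in> edges G"
proof -
  obtain S g where S: "simple_graph S" "verts S \<subseteq> verts G" "edges S \<subseteq> edges G"
    and g: "bij_betw g (verts S) (verts H)" "edges H = (\<lambda>e. g ` e) ` edges S"
    using assms by (auto simp: contains_copy_def subgraph_def isomorphic_def)
  let ?f = "inv_into (verts S) g"
  have f: "bij_betw ?f (verts H) (verts S)" using g(1) by (rule bij_betw_inv_into)
  show ?thesis
  proof (rule that)
    show "inj_on ?f (verts H)" using f by (rule bij_betw_imp_inj_on)
    show "?f ` verts H \<subseteq> verts G" using f S(2) by (simp add: bij_betw_def)
    fix a b assume "{a, b} \<in> edges H"
    then obtain e where e: "e \<in> edges S" "{a, b} = g ` e" using g(2) by auto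
    have "e \<subseteq> verts S" using e(1) S(1) by (auto simp: simple_graph_def nsets_def)
    then have "?f ` g ` e = e"
      using g(1) by (simp add: bij_betw_def inv_into_image_cancel)
    then have "{?f a, ?f b} = e" by (metis e(2) image_empty image_insert)
    then show "{?f a, ?f b} \<in> edges G" using e(1) S(3) by auto
  qed
qed

text \<open>A counterexample is demanded for every \<open>M < N\<close>, not only for
  \<open>N - 1\<close>; this replaces a proof that the Ramsey property passes to larger
  orders.\<close>

lemma ramsey_number_eqI:
  assumes "N > 0"
    and "\<And>G :: nat ugraph. simple_graph G \<Longrightarrow> card (verts G) = N \<Longrightarrow>
           contains_copy G G1 \<or> contains_copy (complement G) G2"
    and "\<And>M. M < N \<Longrightarrow> \<exists>G :: nat ugraph. simple_graph G \<and> card (verts G) = M \<and>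
           \<not> contains_copy G G1 \<and> \<not> contains_copy (complement G) G2"
  shows "ramsey_number G1 G2 = N"
  unfolding ramsey_number_def
proof (rule Least_equality)
  fix M assume "M > 0 \<and> (\<forall>G :: nat ugraph. simple_graph G \<and> card (verts G) = M \<longrightarrow>
    contains_copy G G1 \<or> contains_copy (complement G) G2)"
  then show "N \<le> M" using assms(3)[of M] by (cases "M < N") auto
qed (use assms(1,2) in blast)

text \<open>The embeddings below fix the images of a few special leaves by hand; the other leaves
  are interchangeable, so counting alone places them.\<close>

lemma extend_injection:
  assumes "finite M" "finite K" "S \<subseteq> K" "card K \<le> card M" "inj_on g S" "g ` S \<subseteq> M"
  obtains f where "inj_on f K" "f ` K \<subseteq> M" "\<And>x. x \<in> S \<Longrightarrow> f x = g x"
proof -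
  have fS: "finite S" using assms by (meson finite_subset)
  have "card (K - S) = card K - card S" using fS assms by (simp add: card_Diff_subset)
  moreover have "card (M - g ` S) = card M - card S"
    using fS assms by (simp add: card_Diff_subset card_image)
  ultimately have "card (K - S) \<le> card (M - g ` S)" using assms by simp
  then obtain h where h: "h ` (K - S) \<subseteq> M - g ` S" "inj_on h (K - S)"
    using card_le_inj[of "K - S" "M - g ` S"] assms by auto
  define f where "f x = (if x \<in> S then g x else h x)" for x
  show ?thesis
  proof (rule that[of f])
    have im: "f ` S = g ` S" "f ` (K - S) = h ` (K - S)" by (auto simp: f_def)
    have "inj_on f S" using assms(5) by (subst inj_on_cong[where g = g]) (auto simp: f_def)
    moreover have "inj_on f (K - S)"
      using h(2) by (subst inj_on_cong[where g = h]) (auto simp: f_def)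
    ultimately have "inj_on f (S \<union> (K - S))" using h(1) im unfolding inj_on_Un by blast
    moreover have K: "S \<union> (K - S) = K" using assms(3) by blast
    ultimately show "inj_on f K" by simp
    have "f ` K = g ` S \<union> h ` (K - S)" using im K image_Un[of f S "K - S"] by simp
    then show "f ` K \<subseteq> M" using h(1) assms(6) by blast
  qed (simp add: f_def)
qed

lemma fresh_element:
  assumes "finite F" "card F < card X"
  shows "\<exists>x \<in> X. x \<notin> F"
proof (rule ccontr)
  assume "\<not> ?thesis"
  then have "X \<subseteq> F" by blast
  then show False using card_mono[OF assms(1)] assms(2) by (meson not_le)
qed

section \<open>Stars with three extra pendant edges\<close>

text \<open>A common generalization of \<open>T_2\<close>, \<open>T_3\<close> and \<open>T_cube\<close>: the three vertices outside the
  closed neighbourhood of the centre hang on the leaves \<open>p\<close>, \<open>q\<close>, \<open>r\<close>, which may coincide.\<close>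

definition star3 :: "nat \<Rightarrow> nat \<Rightarrow> nat \<Rightarrow> nat \<Rightarrow> nat ugraph" where
  "star3 m p q r = \<lparr>verts = {0..<m},
     edges = {{0, i} | i. i \<in> {1..m-4}} \<union> {{p, m-3}, {q, m-2}, {r, m-1}}\<rparr>"

lemma simple_graph_star3:
  assumes "m \<ge> 5" "{p, q, r} \<subseteq> {1..m-4}"
  shows "simple_graph (star3 m p q r)"
proof -
  have "e \<in> nsets {0..<m} 2" if e: "e \<in> edges (star3 m p q r)" for e
  proof -
    consider i where "e = {0, i}" "1 \<le> i" "i \<le> m - 4"
      | "e = {p, m-3}" | "e = {q, m-2}" | "e = {r, m-1}"
      using e by (auto simp: star3_def)
    then show ?thesis using assms by cases auto
  qed
  moreover have "verts (star3 m p q r) = {0..<m}" by (simp add: star3_def)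
  ultimately show ?thesis unfolding simple_graph_def by auto
qed

text \<open>Separates the choice of the leaves from that of the three pendant vertices. The latter
  may lie in the neighbourhood of \<open>v\<close>, which is why they are removed from the range of
  \<open>f\<close>.\<close>

lemma contains_copy_star3I:
  assumes G: "simple_graph G" and m: "m \<ge> 5" "{p, q, r} \<subseteq> {1..m-4}"
    and f: "inj_on f {1..m-4}" "f ` {1..m-4} \<subseteq> nbrs G v - {b1, b2, b3}"
    and b: "distinct [v, b1, b2, b3]"
    and e: "b1 \<in> nbrs G (f p)" "b2 \<in> nbrs G (f q)" "b3 \<in> nbrs G (f r)"
  shows "contains_copy G (star3 m p q r)"
proof -
  define g where "g i = (if i = 0 then v else if i \<le> m - 4 then f i else
    if i = m - 3 then b1 else if i = m - 2 then b2 else b3)" for i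
  have v: "v \<notin> nbrs G v" and sub: "\<And>x. nbrs G x \<subseteq> verts G"
    using nbrs_subset[OF G] by auto
  have fn: "f i \<in> nbrs G v" "f i \<noteq> b1" "f i \<noteq> b2" "f i \<noteq> b3" "f i \<noteq> v"
    if "1 \<le> i" "i \<le> m - 4" for i
    using f(2) v that by (auto simp: image_subset_iff)
  have vV: "v \<in> verts G"
    using fn(1)[of 1] m(1) sub nbrs_sym by fastforce
  have cases: "i = 0 \<or> (1 \<le> i \<and> i \<le> m - 4) \<or> i = m - 3 \<or> i = m - 2 \<or> i = m - 1"
    if "i < m" for i using that by linarith
  have gs: "g 0 = v" "g (m - 3) = b1" "g (m - 2) = b2" "g (m - 1) = b3"
    "\<And>i. 1 \<le> i \<Longrightarrow> i \<le> m - 4 \<Longrightarrow> g i = f i"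
    using m(1) by (auto simp: g_def)
  show ?thesis
  proof (rule contains_copyI)
    show "simple_graph (star3 m p q r)" using m by (rule simple_graph_star3)
    have "inj_on g ({1..m-4} \<union> {0, m-3, m-2, m-1})"
      unfolding inj_on_Un
    proof (intro conjI)
      show "inj_on g {1..m-4}" using f(1) gs(5) by (subst inj_on_cong[where g = f]) auto
      show "inj_on g {0, m-3, m-2, m-1}" using gs(1-4) b by (auto simp: inj_on_def)
      have "g ` {0, m-3, m-2, m-1} = {v, b1, b2, b3}" using gs(1-4) by simp
      moreover have "g x \<notin> {v, b1, b2, b3}" if "x \<in> {1..m-4}" for x
        using gs(5)[of x] fn[of x] that by auto
      ultimately show "g ` ({1..m-4} - {0, m-3, m-2, m-1}) \<inter>
          g ` ({0, m-3, m-2, m-1} - {1..m-4}) = {}"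
        by blast
    qed
    moreover have "verts (star3 m p q r) = {1..m-4} \<union> {0, m-3, m-2, m-1}"
      using m(1) by (auto simp: star3_def)
    ultimately show "inj_on g (verts (star3 m p q r))" by simp
    show "g ` verts (star3 m p q r) \<subseteq> verts G"
    proof
      fix x assume "x \<in> g ` verts (star3 m p q r)"
      then obtain i where i: "i < m" "x = g i" by (auto simp: star3_def)
      have "f i \<in> verts G" if "1 \<le> i" "i \<le> m - 4" using fn(1)[OF that] sub by blast
      moreover have "b1 \<in> verts G" "b2 \<in> verts G" "b3 \<in> verts G" using e sub by blast+
      ultimately show "x \<in> verts G" using cases[OF i(1)] i(2) gs vV by metis
    qed
    fix a c assume "{a, c} \<in> edges (star3 m p q r)"
    then consider i where "{a, c} = {0, i}" "1 \<le> i" "i \<le> m - 4"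
      | "{a, c} = {p, m-3}" | "{a, c} = {q, m-2}" | "{a, c} = {r, m-1}"
      by (auto simp: star3_def)
    then have "\<exists>x y. {a, c} = {x, y} \<and> g y \<in> nbrs G (g x)"
    proof cases
      case 1
      then show ?thesis using gs fn by metis
    next
      case 2
      then show ?thesis using gs e m by (intro exI[of _ p] exI[of _ "m-3"]) auto
    next
      case 3
      then show ?thesis using gs e m by (intro exI[of _ q] exI[of _ "m-2"]) auto
    next
      case 4
      then show ?thesis using gs e m by (intro exI[of _ r] exI[of _ "m-1"]) auto
    qed
    then show "{g a, g c} \<in> edges G"
      unfolding nbrs_iff by (metis (no_types, lifting) image_empty image_insert)
  qed
qed

text \<open>The leaves \<open>p\<close>, \<open>q\<close>, \<open>r\<close> and their pendant neighbours can be chosen greedily. The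
  remaining leaves then fit as soon as the pendant vertices waste at most two neighbours of a
  centre of degree \<open>m - 2\<close>, so a single pendant vertex outside its neighbourhood suffices.\<close>

lemma star3_greedy:
  assumes G: "simple_graph G" and m: "m \<ge> 10" "{p, q, r} \<subseteq> {1..m-4}"
    and deg: "\<And>x. x \<in> A \<Longrightarrow> card (nbrs G x \<inter> A) \<ge> m - 2"
    and v: "v \<in> A" and a: "a \<in> nbrs G v \<inter> A" and b: "b \<in> nbrs G a \<inter> A" "b \<noteq> v"
    and room: "b \<notin> nbrs G v \<or> card (nbrs G v \<inter> A) \<ge> m - 1"
  shows "contains_copy G (star3 m p q r)"
proof -
  let ?N = "\<lambda>x. nbrs G x \<inter> A"
  have nself: "x \<notin> nbrs G x" for x using nbrs_subset[OF G] by auto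
  have fin: "finite (?N x)" for x using finite_nbrs[OF G] by simp
  \<comment> \<open>Every vertex of \<open>A\<close> has at least 8 neighbours in \<open>A\<close>,
    so a short list of forbidden vertices can always be avoided.\<close>
  have choose: "\<exists>y \<in> ?N x. y \<notin> set F" if "x \<in> A" "length F \<le> 6" for x F
  proof -
    have "card (set F) < card (?N x)"
      using deg[OF that(1)] card_length[of F] that(2) m(1) by linarith
    then show ?thesis by (intro fresh_element) simp_all
  qed
  \<comment> \<open>\<open>a2\<close>, and later \<open>a3\<close>, must repeat an earlier choice
    exactly when the corresponding leaves among \<open>p\<close>, \<open>q\<close>, \<open>r\<close>
    coincide; this makes \<open>g\<close> injective on them.\<close>
  have "\<exists>a2 \<in> ?N v. a2 \<noteq> b \<and> (a2 = a \<longleftrightarrow> q = p)"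
    using choose[OF v, of "[a, b]"] a b nself by (cases "q = p") auto
  then obtain a2 where a2: "a2 \<in> ?N v" "a2 \<noteq> b" "a2 = a \<longleftrightarrow> q = p" by blast
  obtain b2 where b2: "b2 \<in> ?N a2" "b2 \<notin> {v, a, b}"
    using choose[of a2 "[v, a, b]"] a2 by auto
  have "\<exists>a3 \<in> ?N v. a3 \<notin> {b, b2} \<and> (a3 = a \<longleftrightarrow> r = p) \<and> (a3 = a2 \<longleftrightarrow> r = q)"
  proof -
    consider "r = p" | "r \<noteq> p" "r = q" | "r \<noteq> p" "r \<noteq> q" by blast
    then show ?thesis
    proof cases
      case 1
      then show ?thesis using a a2 b b2 nself by (intro bexI[of _ a]) auto
    next
      case 2
      then show ?thesis using a a2 b b2 nself by (intro bexI[of _ a2]) auto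
    next
      case 3
      then show ?thesis using choose[OF v, of "[a, a2, b, b2]"] by auto
    qed
  qed
  then obtain a3 where a3: "a3 \<in> ?N v" "a3 \<notin> {b, b2}" "a3 = a \<longleftrightarrow> r = p" "a3 = a2 \<longleftrightarrow> r = q"
    by blast
  obtain b3 where b3: "b3 \<in> ?N a3" "b3 \<notin> {v, a, a2, b, b2}"
    using choose[of a3 "[v, a, a2, b, b2]"] a3 by auto
  define g where "g i = (if i = p then a else if i = q then a2 else a3)" for i
  let ?M = "?N v - {b, b2, b3}"
  \<comment> \<open>Either at most three vertices are lost from at least \<open>m - 1\<close>, or
    \<open>b\<close> costs nothing and at most two are lost from at least \<open>m - 2\<close>. Both
    leave \<open>m - 4\<close>.\<close>
  have card: "card {1..m-4} \<le> card ?M"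
  proof (cases "b \<in> nbrs G v")
    case True
    have "card (?N v) - card {b, b2, b3} \<le> card ?M" by (rule diff_card_le_card_Diff) simp
    moreover have "card {b, b2, b3} \<le> 3" by (simp add: card_insert_if)
    ultimately show ?thesis using room True by simp
  next
    case False
    then have "?M = ?N v - {b2, b3}" by auto
    moreover have "card (?N v) - card {b2, b3} \<le> card (?N v - {b2, b3})"
      by (rule diff_card_le_card_Diff) simp
    moreover have "card {b2, b3} \<le> 2" by (simp add: card_insert_if)
    ultimately show ?thesis using deg[OF v] by simp
  qed
  have gM: "g ` {p, q, r} \<subseteq> ?M"
    using a a2 a3 b b2 b3 nself by (auto simp: g_def)
  have ginj: "inj_on g {p, q, r}"
    using a2 a3 by (auto simp: g_def inj_on_def)
  obtain f where f: "inj_on f {1..m-4}" "f ` {1..m-4} \<subseteq> ?M" "\<And>x. x \<in> {p, q, r} \<Longrightarrow> f x = g x"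
    by (rule extend_injection[OF _ _ m(2) card ginj gM]) (use fin in auto)
  have gs: "g p = a" "g q = a2" "g r = a3" using a2 a3 by (auto simp: g_def)
  show ?thesis
  proof (rule contains_copy_star3I[OF G _ m(2) f(1)])
    show "f ` {1..m-4} \<subseteq> nbrs G v - {b, b2, b3}" using f(2) by blast
    show "distinct [v, b, b2, b3]" using b b2 b3 by auto
  qed (use m f(3) gs b b2 b3 in auto)
qed

text \<open>Without a copy of \<open>star3\<close> the closed neighbourhoods of adjacent vertices coincide, so the
  induced graph is a disjoint union of cliques on \<open>m - 1\<close> vertices.\<close>

lemma no_star3_clique_partition:
  assumes G: "simple_graph G" and m: "m \<ge> 10" "{p, q, r} \<subseteq> {1..m-4}"
    and A: "A \<subseteq> verts G" and deg: "\<And>x. x \<in> A \<Longrightarrow> card (nbrs G x \<inter> A) \<ge> m - 2"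
    and no: "\<not> contains_copy G (star3 m p q r)"
  shows "\<forall>x\<in>A. card (nbrs G x \<inter> A) = m - 2" and "m - 1 dvd card A"
proof -
  let ?N = "\<lambda>x. nbrs G x \<inter> A"
  note greedy = star3_greedy[OF G m deg]
  have finA: "finite A" using A G by (meson finite_subset simple_graph_def)
  have nself: "x \<notin> nbrs G x" for x using nbrs_subset[OF G] by auto
  show reg: "\<forall>x\<in>A. card (?N x) = m - 2"
  proof (rule ballI, rule ccontr)
    fix x assume x: "x \<in> A" "card (?N x) \<noteq> m - 2"
    \<comment> \<open>The second alternative of \<open>room\<close> now holds, so any path
      \<open>x\<close>, \<open>a\<close>, \<open>b\<close> inside \<open>A\<close> starts the greedy
      embedding.\<close>
    then have big: "card (?N x) \<ge> m - 1" using deg[of x] by simp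
    then have "card {} < card (?N x)" using m(1) by simp
    then obtain a where a: "a \<in> ?N x" using fresh_element[of "{}" "?N x"] by blast
    then have "card {x} < card (?N a)" using deg[of a] m(1) by simp
    then obtain b where "b \<in> ?N a" "b \<noteq> x" using fresh_element[of "{x}" "?N a"] by blast
    then show False using greedy[of x a b] a x big no by blast
  qed
  define C where "C x = insert x (?N x)" for x
  have cardC: "card (C x) = m - 1" if "x \<in> A" for x
    using reg that nself finA m(1) by (simp add: C_def)
  \<comment> \<open>A vertex of \<open>C y\<close> outside \<open>C x\<close> would be a
    \<open>b\<close> satisfying the first alternative of \<open>room\<close>. Hence
    \<open>C y\<close> lies in \<open>C x\<close>, and equal sizes give equality.\<close>
  have C_eq: "C y = C x" if "x \<in> A" "y \<in> ?N x" for x y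
  proof (rule card_subset_eq)
    show "finite (C x)" using finA by (simp add: C_def)
    show "C y \<subseteq> C x"
    proof
      fix b assume "b \<in> C y"
      then show "b \<in> C x" using greedy[of x y b] that no by (auto simp: C_def)
    qed
    show "card (C y) = card (C x)" using cardC that by simp
  qed
  have "(m - 1) * card (C ` A) = card (\<Union> (C ` A))"
  proof (rule card_partition)
    show "c1 \<inter> c2 = {}" if c: "c1 \<in> C ` A" "c2 \<in> C ` A" "c1 \<noteq> c2" for c1 c2
    proof (rule ccontr)
      assume "c1 \<inter> c2 \<noteq> {}"
      moreover obtain x y where "c1 = C x" "c2 = C y" "x \<in> A" "y \<in> A" using c by auto
      moreover have "C z = C x" if "x \<in> A" "z \<in> C x" for z x
        using C_eq[OF that(1), of z] that by (auto simp: C_def)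
      ultimately show False using c(3) by (metis disjoint_iff)
    qed
  qed (use finA cardC in \<open>auto simp: C_def\<close>)
  moreover have "\<Union> (C ` A) = A" by (auto simp: C_def)
  ultimately show "m - 1 dvd card A" by (metis dvd_triv_left)
qed

section \<open>Copies of the two near-stars\<close>

lemma simple_graph_T_star: "n \<ge> 4 \<Longrightarrow> simple_graph (T_star n)"
  by (auto simp: simple_graph_def T_star_def nsets_def card_insert_if)

text \<open>The path \<open>v\<close>, \<open>u\<close>, \<open>w\<close>, \<open>x\<close> carries
  the tail of the tree: \<open>u\<close> is the image of the leaf \<open>n-3\<close>, and only
  \<open>w\<close> and \<open>x\<close> must be kept out of the leaves.\<close>

lemma contains_copy_T_starI:
  assumes H: "simple_graph H" and n: "n \<ge> 4"
    and u: "u \<in> nbrs H v" "w \<in> nbrs H u" "x \<in> nbrs H w" "w \<noteq> v" "x \<noteq> v" "x \<noteq> u"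
    and card: "card (nbrs H v - {w, x}) \<ge> n - 3"
  shows "contains_copy H (T_star n)"
proof -
  have sub: "\<And>y. nbrs H y \<subseteq> verts H" and nself: "\<And>y. y \<notin> nbrs H y"
    using nbrs_subset[OF H] by auto
  have uM: "(\<lambda>_. u) ` {n-3} \<subseteq> nbrs H v - {w, x}" using u nself by auto
  obtain f where f: "inj_on f {1..n-3}" "f ` {1..n-3} \<subseteq> nbrs H v - {w, x}" "f (n-3) = u"
    by (rule extend_injection[of "nbrs H v - {w, x}" "{1..n-3}" "{n-3}" "\<lambda>_. u"])
      (use uM card n finite_nbrs[OF H] in auto)
  define g where "g i = (if i = 0 then v else if i \<le> n - 3 then f i else
    if i = n - 2 then w else x)" for i
  have gs: "g 0 = v" "g (n - 2) = w" "g (n - 1) = x" "g (n - 3) = u"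
    "\<And>i. 1 \<le> i \<Longrightarrow> i \<le> n - 3 \<Longrightarrow> g i = f i"
    using n f(3) by (auto simp: g_def)
  have fn: "f i \<in> nbrs H v" "f i \<noteq> w" "f i \<noteq> x" "f i \<noteq> v" if "1 \<le> i" "i \<le> n - 3" for i
    using f(2) nself[of v] that by (auto simp: image_subset_iff)
  have cases: "i = 0 \<or> (1 \<le> i \<and> i \<le> n - 3) \<or> i = n - 2 \<or> i = n - 1"
    if "i < n" for i using that by linarith
  have wx: "w \<noteq> x" using u(3) nself by auto
  show ?thesis
  proof (rule contains_copyI)
    show "simple_graph (T_star n)" using n by (rule simple_graph_T_star)
    have "inj_on g ({1..n-3} \<union> {0, n-2, n-1})"
      unfolding inj_on_Un
    proof (intro conjI)
      show "inj_on g {1..n-3}" using f(1) gs(5) by (subst inj_on_cong[where g = f]) auto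
      show "inj_on g {0, n-2, n-1}" using gs(1-3) u wx by (auto simp: inj_on_def)
      have "g ` {0, n-2, n-1} = {v, w, x}" using gs(1-3) by simp
      moreover have "g y \<notin> {v, w, x}" if "y \<in> {1..n-3}" for y
        using gs(5)[of y] fn[of y] that by auto
      ultimately show "g ` ({1..n-3} - {0, n-2, n-1}) \<inter> g ` ({0, n-2, n-1} - {1..n-3}) = {}"
        by blast
    qed
    moreover have "verts (T_star n) = {1..n-3} \<union> {0, n-2, n-1}"
      using n by (auto simp: T_star_def)
    ultimately show "inj_on g (verts (T_star n))" by simp
    show "g ` verts (T_star n) \<subseteq> verts H"
    proof
      fix y assume "y \<in> g ` verts (T_star n)"
      then obtain i where i: "i < n" "y = g i" by (auto simp: T_star_def)
      have "v \<in> verts H" using u(1) sub[of u] nbrs_sym[of u H v] by blast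
      moreover have "f i \<in> verts H" if "1 \<le> i" "i \<le> n - 3" using fn(1)[OF that] sub by blast
      moreover have "w \<in> verts H" "x \<in> verts H" using u sub by blast+
      ultimately show "y \<in> verts H" using cases[OF i(1)] i(2) gs by metis
    qed
    fix a c assume "{a, c} \<in> edges (T_star n)"
    then consider i where "{a, c} = {0, i}" "1 \<le> i" "i \<le> n - 3"
      | "{a, c} = {n-3, n-2}" | "{a, c} = {n-2, n-1}"
      by (auto simp: T_star_def)
    then have "\<exists>x y. {a, c} = {x, y} \<and> g y \<in> nbrs H (g x)"
    proof cases
      case 1
      then show ?thesis using gs(1,5) fn(1) by (intro exI[of _ 0] exI[of _ i]) simp
    next
      case 2
      then show ?thesis using gs(2,4) u(2) by (intro exI[of _ "n-3"] exI[of _ "n-2"]) simp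
    next
      case 3
      then show ?thesis using gs(2,3) u(3) by (intro exI[of _ "n-2"] exI[of _ "n-1"]) simp
    qed
    then show "{g a, g c} \<in> edges H"
      unfolding nbrs_iff by (metis (no_types, lifting) image_empty image_insert)
  qed
qed

text \<open>A vertex \<open>c\<close> of degree \<open>n - 2\<close> misses exactly one other vertex
  \<open>z\<close>. Connectivity attaches \<open>z\<close> to some neighbour \<open>u\<close> of
  \<open>c\<close>; any further edge would close a triangle or a 4-cycle through
  \<open>c\<close>.\<close>

lemma is_T'_structure:
  assumes T: "is_T' n T" and n: "n \<ge> 3"
  obtains c u z where "simple_graph T" "card (nbrs T c) = n - 2" "u \<in> nbrs T c"
    "z \<notin> nbrs T c" "z \<noteq> c" "c \<notin> nbrs T c" "verts T = insert c (insert z (nbrs T c))"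
    "edges T = (\<lambda>x. {c, x}) ` nbrs T c \<union> {{u, z}}"
proof -
  have S: "simple_graph T" and conn: "connected_graph T" and acyc: "\<And>vs. \<not> is_cycle T vs"
    and card: "card (verts T) = n" and max: "max_degree T = n - 2"
    using T by (auto simp: is_T'_def is_tree_def)
  have fin: "finite (verts T)" using S by (simp add: simple_graph_def)
  have "max_degree T \<in> degree T ` verts T"
    unfolding max_degree_def using fin card n by (intro Max_in) auto
  then obtain c where c: "c \<in> verts T" "card (nbrs T c) = n - 2"
    using max degree_eq_card_nbrs[OF S] by auto
  let ?K = "nbrs T c"
  have K: "?K \<subseteq> verts T - {c}" using nbrs_subset[OF S] .
  have "card (verts T - {c} - ?K) = 1"
    using K c card n finite_nbrs[OF S] fin by (simp add: card_Diff_subset)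
  then obtain z where "verts T - {c} - ?K = {z}" by (auto simp: card_1_singleton_iff)
  then have z: "z \<in> verts T" "z \<noteq> c" "z \<notin> ?K" and V: "verts T = insert c (insert z ?K)"
    using K c(1) by auto
  have "(c, z) \<in> {(x, y). {x, y} \<in> edges T}\<^sup>*"
    using conn c(1) z(1) by (simp add: connected_graph_def)
  then obtain u where uz: "{u, z} \<in> edges T" using z(2) by (auto elim: rtranclE)
  then have "u \<in> verts T" "u \<noteq> z" using simple_graph_edgeD[OF S] by auto
  moreover have "u \<noteq> c" using uz z(3) by (auto simp: nbrs_iff)
  ultimately have u: "u \<in> ?K" using V by auto
  have tri: False if "a \<in> ?K" "b \<in> ?K" "{a, b} \<in> edges T" for a b
  proof -
    have "c \<noteq> a" "c \<noteq> b" "a \<noteq> b" using that(1,2) simple_graph_edgeD[OF S that(3)] K by blast+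
    then have "is_cycle T [c, a, b]"
      using that
      by (auto simp: is_cycle_def nbrs_iff less_Suc_eq insert_commute)
    then show False using acyc by blast
  qed
  have quad: "a = u" if "a \<in> ?K" "{a, z} \<in> edges T" for a
  proof (rule ccontr)
    assume "a \<noteq> u"
    moreover have "c \<noteq> a" "c \<noteq> u" "z \<noteq> a" "z \<noteq> u" using that(1) z u K by blast+
    ultimately have "is_cycle T [c, a, z, u]"
      using that z(2) u uz by (auto simp: is_cycle_def nbrs_iff less_Suc_eq insert_commute)
    then show False using acyc by blast
  qed
  have "edges T = (\<lambda>x. {c, x}) ` ?K \<union> {{u, z}}"
  proof (intro equalityI subsetI)
    fix e assume e: "e \<in> edges T"
    obtain a b where ab: "e = {a, b}" "a \<noteq> b" "a \<in> verts T" "b \<in> verts T"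
      using simple_graph_edgeE[OF S e] .
    then show "e \<in> (\<lambda>x. {c, x}) ` ?K \<union> {{u, z}}"
      using e V tri[of a b] quad[of a] quad[of b]
      by (auto simp: nbrs_iff insert_commute)
  qed (use uz in \<open>auto simp: nbrs_iff\<close>)
  then show ?thesis using that[OF S c(2) u z(3) z(2) _ V] K by auto
qed

lemma contains_copy_T'I:
  assumes H: "simple_graph H" and T: "is_T' n T" and n: "n \<ge> 3"
    and u: "u \<in> nbrs H v" "w \<in> nbrs H u" "w \<noteq> v" and card: "card (nbrs H v - {w}) \<ge> n - 2"
  shows "contains_copy H T"
proof -
  obtain c u0 z where S: "simple_graph T" and K: "card (nbrs T c) = n - 2" "u0 \<in> nbrs T c"
    "z \<notin> nbrs T c" "z \<noteq> c" "c \<notin> nbrs T c" and V: "verts T = insert c (insert z (nbrs T c))"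
    and E: "edges T = (\<lambda>x. {c, x}) ` nbrs T c \<union> {{u0, z}}"
    using is_T'_structure[OF T n] .
  let ?K = "nbrs T c"
  have sub: "\<And>y. nbrs H y \<subseteq> verts H" and nself: "\<And>y. y \<notin> nbrs H y"
    using nbrs_subset[OF H] by auto
  have uM: "(\<lambda>_. u) ` {u0} \<subseteq> nbrs H v - {w}" using u nself by auto
  obtain f where f: "inj_on f ?K" "f ` ?K \<subseteq> nbrs H v - {w}" "f u0 = u"
    by (rule extend_injection[of "nbrs H v - {w}" ?K "{u0}" "\<lambda>_. u"])
      (use uM card n K finite_nbrs[OF H] finite_nbrs[OF S] in auto)
  define g where "g x = (if x = c then v else if x = z then w else f x)" for x
  have gs: "g c = v" "g z = w" "g u0 = u" "\<And>x. x \<in> ?K \<Longrightarrow> g x = f x"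
    using K f(3) by (auto simp: g_def)
  have fn: "f x \<in> nbrs H v" "f x \<noteq> w" "f x \<noteq> v" if "x \<in> ?K" for x
    using f(2) nself[of v] that by (auto simp: image_subset_iff)
  show ?thesis
  proof (rule contains_copyI[OF S])
    have "inj_on g (nbrs T c \<union> {c, z})"
      unfolding inj_on_Un
    proof (intro conjI)
      show "inj_on g (nbrs T c)" using f(1) gs(4) by (subst inj_on_cong[where g = f]) auto
      show "inj_on g {c, z}" using gs(1,2) u(3) by (auto simp: inj_on_def)
      have "g ` {c, z} = {v, w}" using gs(1,2) by simp
      moreover have "g x \<notin> {v, w}" if "x \<in> nbrs T c" for x
        using gs(4)[OF that] fn[OF that] by auto
      ultimately show "g ` (nbrs T c - {c, z}) \<inter> g ` ({c, z} - nbrs T c) = {}"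
        by blast
    qed
    moreover have "verts T = nbrs T c \<union> {c, z}" unfolding V by auto
    ultimately show "inj_on g (verts T)" by simp
    have "v \<in> verts H" using u(1) sub[of u] nbrs_sym[of u H v] by blast
    moreover have "w \<in> verts H" using u sub by blast
    moreover have "g x \<in> verts H" if "x \<in> nbrs T c" for x 
      using gs(4)[OF that] fn(1)[OF that] sub[of v] by auto
    ultimately show "g ` verts T \<subseteq> verts H" using gs(1,2) unfolding V by auto
    fix a b assume "{a, b} \<in> edges T"
    then have "\<exists>x y. {a, b} = {x, y} \<and> g y \<in> nbrs H (g x)"
      unfolding E
    proof (elim UnE imageE singletonE)
      fix x assume "{a, b} = {c, x}" "x \<in> nbrs T c"
      then show ?thesis using gs(1,4) fn(1) by (intro exI[of _ c] exI[of _ x]) simp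
    next
      assume "{a, b} = {u0, z}"
      then show ?thesis using gs(2,3) u(2) by (intro exI[of _ u0] exI[of _ z]) simp
    qed
    then show "{g a, g b} \<in> edges H"
      unfolding nbrs_iff by (metis (no_types, lifting) image_empty image_insert)
  qed
qed

section \<open>The upper bound\<close>

text \<open>The hypothesis \<open>path\<close> is the common reason why a complement avoiding either near-star is
  sparse around a vertex of large degree.\<close>

lemma star3_or_near_star:
  fixes G :: "'a ugraph"
  assumes G: "simple_graph G" and m: "m \<ge> 10" "{p, q, r} \<subseteq> {1..m-4}" and n: "n > m"
    and N: "card (verts G) \<ge> m + n - 4"
    and big: "card (verts G) \<ge> m + n - 3 \<or> \<not> m - 1 dvd card (verts G)"
    and path: "\<And>v w x y. x \<in> nbrs (complement G) v \<Longrightarrow> y \<in> nbrs (complement G) v \<Longrightarrow> x \<noteq> y \<Longrightarrow>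
      w \<noteq> v \<Longrightarrow> x \<in> nbrs (complement G) w \<Longrightarrow> y \<in> nbrs (complement G) w \<Longrightarrow>
      card (nbrs (complement G) v - {w}) \<ge> n - 2 \<Longrightarrow> contains_copy (complement G) S"
  shows "contains_copy G (star3 m p q r) \<or> contains_copy (complement G) S"
proof (rule ccontr)
  assume neg: "\<not> ?thesis"
  let ?V = "verts G" and ?H = "complement G"
  have noG: "\<not> contains_copy G (star3 m p q r)" and noH: "\<not> contains_copy ?H S"
    using neg by auto
  have fin: "finite ?V" using G by (simp add: simple_graph_def)
  have H: "simple_graph ?H" using G by (rule simple_graph_complement)
  have subG: "nbrs G x \<subseteq> ?V - {x}" and subH: "nbrs ?H x \<subseteq> ?V - {x}" for x
    using nbrs_subset[OF G] nbrs_subset[OF H] by auto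
  have comp: "nbrs G x = ?V - {x} - nbrs ?H x" if "x \<in> ?V" for x
    using nbrs_complement[OF that] subG[of x] by auto
  have degsum: "card (nbrs G x) = card ?V - 1 - card (nbrs ?H x)" if "x \<in> ?V" for x
    using comp[OF that] subH[of x] finite_nbrs[OF H] fin that by (simp add: card_Diff_subset)
  note partition = no_star3_clique_partition[OF G m _ _ noG]
  show False
  proof (cases "\<forall>v\<in>?V. card (nbrs ?H v) \<le> n - 3")
    case True
    have int: "nbrs G x \<inter> ?V = nbrs G x" for x using subG by auto
    have deg: "card (nbrs G x \<inter> ?V) \<ge> card ?V - 1 - (n - 3)" if "x \<in> ?V" for x
      using degsum[OF that] True that int by auto
    then have deg': "card (nbrs G x \<inter> ?V) \<ge> m - 2" if "x \<in> ?V" for x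
      using N n m(1) that by fastforce
    have "card ?V > 0" using N n m(1) by linarith
    then obtain x where "x \<in> ?V" by (metis card_gt_0_iff ex_in_conv)
    \<comment> \<open>Regularity of degree \<open>m - 2\<close> bounds the order by
      \<open>m + n - 4\<close>; together with divisibility this contradicts
      \<open>big\<close>.\<close>
    then have "card ?V - 1 - (n - 3) \<le> m - 2"
      using partition(1)[OF order_refl deg'] deg by fastforce
    moreover have "m - 1 dvd card ?V"
      using partition(2)[OF order_refl deg'] .
    ultimately show False using big n m(1) by linarith
  next
    case False
    then obtain v where v: "v \<in> ?V" "card (nbrs ?H v) \<ge> n - 2" by fastforce
    let ?A = "nbrs ?H v"
    have finA: "finite ?A" using finite_nbrs[OF H] .
    \<comment> \<open>Two \<open>?H\<close>-neighbours of \<open>w\<close> in \<open>?A\<close>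
      would be common neighbours of \<open>v\<close> and \<open>w\<close>, and \<open>path\<close>
      would produce the near-star.\<close>
    have few: "card (nbrs ?H w \<inter> ?A) \<le> 1" if "w \<noteq> v" "card (?A - {w}) \<ge> n - 2" for w
    proof (rule ccontr)
      assume "\<not> ?thesis"
      then obtain x y where "x \<in> nbrs ?H w \<inter> ?A" "y \<in> nbrs ?H w \<inter> ?A" "x \<noteq> y"
        using finA by (metis card_le_Suc0_iff_eq finite_Int One_nat_def)
      then show False using path[of x v y w] that noH by blast
    qed
    show False
    proof (cases "card ?A \<ge> n - 1")
      case True
      \<comment> \<open>\<open>few\<close> applies to every \<open>x\<close> in \<open>?A\<close>,
        since deleting \<open>x\<close> still leaves \<open>n - 2\<close> vertices. So
        \<open>x\<close> misses at most itself and one \<open>?H\<close>-neighbour.\<close>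
      have deg: "card (nbrs G x \<inter> ?A) \<ge> card ?A - 2" if x: "x \<in> ?A" for x
      proof -
        have xV: "x \<in> ?V" "x \<noteq> v" using x subH by auto
        have "card (nbrs ?H x \<inter> ?A) \<le> 1"
          using few[of x] xV x True finA by (simp add: card_Diff_singleton)
        then have "card (insert x (nbrs ?H x \<inter> ?A)) \<le> 2"
          using finA by (simp add: card_insert_if)
        moreover have "nbrs G x \<inter> ?A = ?A - insert x (nbrs ?H x \<inter> ?A)"
          using comp[OF xV(1)] subH[of v] by auto
        moreover have "card ?A - card (insert x (nbrs ?H x \<inter> ?A)) \<le>
            card (?A - insert x (nbrs ?H x \<inter> ?A))"
          using finA by (intro diff_card_le_card_Diff) auto
        ultimately show ?thesis by (metis diff_le_mono2 le_trans)
      qed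
      have deg': "card (nbrs G x \<inter> ?A) \<ge> m - 2" if "x \<in> ?A" for x
        using deg[OF that] True n by linarith
      have AV: "?A \<subseteq> ?V" using subH by auto
      have "card ?A > 0" using True n m(1) by linarith
      then obtain x where x: "x \<in> ?A" by (metis card_gt_0_iff ex_in_conv)
      have "card (nbrs G x \<inter> ?A) = m - 2" using partition(1)[OF AV deg'] x by blast
      \<comment> \<open>As \<open>card ?A \<ge> n - 1 \<ge> m\<close>, only
        \<open>card ?A = m\<close> remains, which is not a multiple of \<open>m - 1\<close>.\<close>
      then have "card ?A \<le> m" using deg[OF x] m(1) by linarith
      then have "card ?A = (m - 1) + 1" using True n m(1) by linarith
      moreover have "m - 1 dvd card ?A" using partition(2)[OF AV deg'] .
      ultimately have "m - 1 dvd 1" by (metis dvd_add_right_iff dvd_refl)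
      then show False using m(1) by simp
    next
      case False
      then have cA: "card ?A = n - 2" using v(2) by linarith
      let ?W = "nbrs G v"
      \<comment> \<open>The \<open>G\<close>-degree of \<open>v\<close> may be as low as
        \<open>m - 3\<close>; this suffices because the pendant vertices come from \<open>?A\<close>
        and use up none of \<open>?W\<close>.\<close>
      have "card ?W \<ge> m - 3" using degsum[OF v(1)] cA N n m(1) by simp
      then have "card {1..m-4} \<le> card ?W" by simp
      then obtain f where f: "f ` {1..m-4} \<subseteq> ?W" "inj_on f {1..m-4}"
        using card_le_inj[of "{1..m-4}" ?W] finite_nbrs[OF G] by auto
      have pendant: "\<exists>b \<in> ?A. b \<in> nbrs G (f i) \<and> b \<notin> set F"
        if "i \<in> {1..m-4}" "length F \<le> 2" for i F
      proof -
        have w: "f i \<in> ?W" using f(1) that by auto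
        then have wV: "f i \<in> ?V" "f i \<noteq> v" "f i \<notin> ?A"
          using subG[of v] comp[OF v(1)] by auto
        \<comment> \<open>\<open>f i\<close> lies outside \<open>?A\<close>, so deleting it keeps
          the \<open>n - 2\<close> vertices that \<open>few\<close> requires.\<close>
        then have "card (nbrs ?H (f i) \<inter> ?A) \<le> 1" using few[of "f i"] cA by simp
        then have "card ((nbrs ?H (f i) \<inter> ?A) \<union> set F) < card ?A"
          using card_Un_le[of "nbrs ?H (f i) \<inter> ?A" "set F"] card_length[of F] that(2) cA n m(1)
          by linarith
        then obtain b where "b \<in> ?A" "b \<notin> (nbrs ?H (f i) \<inter> ?A) \<union> set F"
          using fresh_element[of "(nbrs ?H (f i) \<inter> ?A) \<union> set F" ?A] finA by auto
        then show ?thesis using comp[OF wV(1)] wV(3) subH[of v] by auto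
      qed
      obtain b1 where b1: "b1 \<in> ?A" "b1 \<in> nbrs G (f p)"
        using pendant[of p "[]"] m(2) by auto
      obtain b2 where b2: "b2 \<in> ?A" "b2 \<in> nbrs G (f q)" "b2 \<noteq> b1"
        using pendant[of q "[b1]"] m(2) by auto
      obtain b3 where b3: "b3 \<in> ?A" "b3 \<in> nbrs G (f r)" "b3 \<noteq> b1" "b3 \<noteq> b2"
        using pendant[of r "[b1, b2]"] m(2) by auto
      have "contains_copy G (star3 m p q r)"
      proof (rule contains_copy_star3I[OF G _ m(2) f(2)])
        show "f ` {1..m-4} \<subseteq> nbrs G v - {b1, b2, b3}"
          using f(1) comp[OF v(1)] b1 b2 b3 by auto
        show "distinct [v, b1, b2, b3]" using b1 b2 b3 subH[of v] by auto
      qed (use m(1) b1 b2 b3 in auto)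
      then show False using noG by blast
    qed
  qed
qed

section \<open>The lower bound\<close>

text \<open>The labelling \<open>b\<close> lives on all of \<open>nat\<close>, so lowering the
  number of vertices gives an induced subgraph with the same labels. This supplies counterexamples
  of every smaller order.\<close>

definition cluster_graph :: "(nat \<Rightarrow> 'b) \<Rightarrow> nat \<Rightarrow> nat ugraph" where
  "cluster_graph b N = \<lparr>verts = {..<N}, edges = {{i, j} | i j. i < N \<and> j < N \<and> i \<noteq> j \<and> b i = b j}\<rparr>"

lemma simple_graph_cluster_graph: "simple_graph (cluster_graph b N)"
  by (auto simp: simple_graph_def cluster_graph_def nsets_def)

lemma cluster_graph_edge_iff:
  "{i, j} \<in> edges (cluster_graph b N) \<longleftrightarrow> i < N \<and> j < N \<and> i \<noteq> j \<and> b i = b j"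
  by (auto simp: cluster_graph_def doubleton_eq_iff)

lemma cluster_graph_complement_edge_iff:
  "{i, j} \<in> edges (complement (cluster_graph b N)) \<longleftrightarrow> i < N \<and> j < N \<and> b i \<noteq> b j"
  unfolding edges_complement_iff cluster_graph_edge_iff by (auto simp: cluster_graph_def)

text \<open>\<open>star3\<close> is connected, so a copy lies within one cluster, which has fewer
  than \<open>m\<close> vertices. Cluster sizes are measured at the larger order \<open>N\<close>,
  so one labelling serves all \<open>M \<le> N\<close>.\<close>

lemma cluster_graph_no_star3:
  assumes m: "m \<ge> 5" "{p, q, r} \<subseteq> {1..m-4}" and M: "M \<le> N"
    and small: "\<And>i. i < N \<Longrightarrow> card {j. j < N \<and> b j = b i} \<le> m - 1"
  shows "\<not> contains_copy (cluster_graph b M) (star3 m p q r)"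
proof
  assume "contains_copy (cluster_graph b M) (star3 m p q r)"
  then obtain f where f: "inj_on f {0..<m}" "f ` {0..<m} \<subseteq> {..<M}"
    and e: "\<And>x y. {x, y} \<in> edges (star3 m p q r) \<Longrightarrow> {f x, f y} \<in> edges (cluster_graph b M)"
    by (rule contains_copyE) (auto simp: star3_def cluster_graph_def)
  have fN: "f i < N" if "i < m" for i
  proof -
    have "f i \<in> {..<M}" using f(2) that by (meson atLeastLessThan_iff image_subset_iff le0)
    then show ?thesis using M by simp
  qed
  have leaf: "b (f i) = b (f 0)" if "i \<in> {1..m-4}" for i
  proof -
    have "{0, i} \<in> edges (star3 m p q r)" using that by (auto simp: star3_def)
    from e[OF this] show ?thesis unfolding cluster_graph_edge_iff by simp
  qed
  have pend: "b (f (m-3)) = b (f 0)" "b (f (m-2)) = b (f 0)" "b (f (m-1)) = b (f 0)"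
  proof -
    have "{p, m-3} \<in> edges (star3 m p q r)" "{q, m-2} \<in> edges (star3 m p q r)"
      "{r, m-1} \<in> edges (star3 m p q r)" by (auto simp: star3_def)
    from this[THEN e] show "b (f (m-3)) = b (f 0)" "b (f (m-2)) = b (f 0)" "b (f (m-1)) = b (f 0)"
      using leaf[of p] leaf[of q] leaf[of r] m(2) unfolding cluster_graph_edge_iff by simp_all
  qed
  have same: "b (f i) = b (f 0)" if "i < m" for i
  proof -
    have "i = 0 \<or> i \<in> {1..m-4} \<or> i = m - 3 \<or> i = m - 2 \<or> i = m - 1"
      using that by auto
    then show ?thesis using leaf pend by metis
  qed
  have "f ` {0..<m} \<subseteq> {j. j < N \<and> b j = b (f 0)}"
  proof (rule image_subsetI)
    fix i assume "i \<in> {0..<m}"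
    then show "f i \<in> {j. j < N \<and> b j = b (f 0)}" using same[of i] fN[of i] by simp
  qed
  then have "card (f ` {0..<m}) \<le> card {j. j < N \<and> b j = b (f 0)}" by (intro card_mono) auto
  moreover have "f 0 < N" using fN m(1) by simp
  ultimately show False using small[of "f 0"] f(1) m(1) by (simp add: card_image)
qed

lemma card_other_clusters:
  fixes N :: nat
  assumes "N - k \<le> card {j. j < N \<and> b j = c}"
  shows "card {j. j < N \<and> b j \<noteq> c} \<le> k"
proof -
  have "{..<N} = {j. j < N \<and> b j = c} \<union> {j. j < N \<and> b j \<noteq> c}" by auto
  then have "N = card {j. j < N \<and> b j = c} + card {j. j < N \<and> b j \<noteq> c}"
    by (metis (no_types, lifting) card_Un_disjoint card_lessThan disjoint_iff finite_Un
        finite_lessThan mem_Collect_eq)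
  then show ?thesis using assms by linarith
qed

text \<open>The \<open>n - 2\<close> neighbours of the centre lie in clusters other than its own,
  and those have at most \<open>n - 3\<close> vertices in all.\<close>

lemma cluster_graph_complement_no_T':
  assumes T: "is_T' n T" and n: "n \<ge> 3" and M: "M \<le> N"
    and large: "\<And>i. i < N \<Longrightarrow> N - (n - 3) \<le> card {j. j < N \<and> b j = b i}"
  shows "\<not> contains_copy (complement (cluster_graph b M)) T"
proof
  assume "contains_copy (complement (cluster_graph b M)) T"
  then obtain f where f: "inj_on f (verts T)" "f ` verts T \<subseteq> {..<M}"
    and e: "\<And>x y. {x, y} \<in> edges T \<Longrightarrow> {f x, f y} \<in> edges (complement (cluster_graph b M))"
    by (rule contains_copyE) (auto simp: cluster_graph_def)
  obtain c where c: "card (nbrs T c) = n - 2" "verts T \<supseteq> insert c (nbrs T c)"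
    using is_T'_structure[OF T n] by (metis insert_mono subset_insertI)
  have "f ` nbrs T c \<subseteq> {j. j < N \<and> b j \<noteq> b (f c)}"
    using e[of c] M unfolding cluster_graph_complement_edge_iff nbrs_def by fastforce
  then have "card (f ` nbrs T c) \<le> card {j. j < N \<and> b j \<noteq> b (f c)}" by (intro card_mono) auto
  moreover have "card (f ` nbrs T c) = n - 2"
    using c f(1) by (metis card_image inj_on_subset insert_subset)
  moreover have "f c < N" using f(2) c(2) M by auto
  ultimately show False using card_other_clusters[OF large[of "f c"]] n by linarith
qed

text \<open>The centre's \<open>n - 3\<close> neighbours exhaust all other clusters, so the last two vertices fall
  into the cluster of the centre and are not adjacent in the complement.\<close>

lemma cluster_graph_complement_no_T_star:
  assumes n: "n \<ge> 4" and M: "M \<le> N"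
    and large: "\<And>i. i < N \<Longrightarrow> N - (n - 3) \<le> card {j. j < N \<and> b j = b i}"
  shows "\<not> contains_copy (complement (cluster_graph b M)) (T_star n)"
proof
  assume "contains_copy (complement (cluster_graph b M)) (T_star n)"
  then obtain f where f: "inj_on f {0..<n}" "f ` {0..<n} \<subseteq> {..<M}"
    and e: "\<And>x y. {x, y} \<in> edges (T_star n) \<Longrightarrow> {f x, f y} \<in> edges (complement (cluster_graph b M))"
    by (rule contains_copyE) (auto simp: cluster_graph_def T_star_def)
  have fN: "f i < N" if "i < n" for i
  proof -
    have "f i \<in> {..<M}" using f(2) that by (meson atLeastLessThan_iff image_subset_iff le0)
    then show ?thesis using M by simp
  qed
  let ?B = "{j. j < N \<and> b j \<noteq> b (f 0)}"
  have "f ` {1..n-3} \<subseteq> ?B"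
  proof
    fix y assume "y \<in> f ` {1..n-3}"
    then obtain i where "i \<in> {1..n-3}" "y = f i" by blast
    moreover from this have "{0, i} \<in> edges (T_star n)" by (auto simp: T_star_def)
    from e[OF this] have "f i < M" "b (f 0) \<noteq> b (f i)"
      unfolding cluster_graph_complement_edge_iff by simp_all
    ultimately show "y \<in> ?B" using M by auto
  qed
  moreover have "{1..n-3} \<subseteq> {0..<n}" using n by auto
  then have "card (f ` {1..n-3}) = n - 3" using inj_on_subset[OF f(1)] by (simp add: card_image)
  moreover have "f 0 < N" using fN n by simp
  then have "card ?B \<le> n - 3" by (intro card_other_clusters large)
  ultimately have B: "f ` {1..n-3} = ?B" by (intro card_seteq) auto
  have same: "b (f i) = b (f 0)" if "i \<in> {n-2, n-1}" for i
  proof (rule ccontr)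
    assume "b (f i) \<noteq> b (f 0)"
    moreover have "f i < N" using fN[of i] n that by auto
    ultimately have "f i \<in> f ` {1..n-3}" using B by blast
    then obtain j where "j \<in> {1..n-3}" "f i = f j" by blast
    then have "i = j" using f(1) that n by (auto simp: inj_on_def)
    then show False using that n \<open>j \<in> {1..n-3}\<close> by auto
  qed
  have "{n-2, n-1} \<in> edges (T_star n)" by (auto simp: T_star_def)
  then show False
    using e[of "n-2" "n-1"] same unfolding cluster_graph_complement_edge_iff by auto
qed

section \<open>Clusterings with two prescribed cluster sizes\<close>

lemma exists_clustering:
  fixes s t x y :: nat
  assumes "s > 0" "t > 0"
  obtains b :: "nat \<Rightarrow> nat"
    where "\<And>i. i < s * x + t * y \<Longrightarrow> card {j. j < s * x + t * y \<and> b j = b i} \<in> {s, t}"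
proof -
  let ?N = "s * x + t * y"
  \<comment> \<open>First \<open>x\<close> blocks of length \<open>s\<close> with labels below
    \<open>x\<close>, then \<open>y\<close> blocks of length \<open>t\<close> with labels from
    \<open>x\<close> on, so the two kinds share no label.\<close>
  define b where "b i = (if i < s * x then i div s else x + (i - s * x) div t)" for i
  have "card {j. j < ?N \<and> b j = b i} \<in> {s, t}" if i: "i < ?N" for i
  proof (cases "i < s * x")
    case True
    define c where "c = i div s"
    have "c < x" using True by (simp add: c_def less_mult_imp_div_less mult.commute)
    then have le: "s * c + s \<le> s * x" by (metis Suc_leI mult_Suc_right mult_le_mono2 add.commute)
    have "{j. j < ?N \<and> b j = b i} = {s * c..<s * c + s}"
    proof (intro equalityI subsetI)
      fix j assume "j \<in> {j. j < ?N \<and> b j = b i}"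
      then have "j div s = c" using True \<open>c < x\<close> by (auto simp: b_def c_def split: if_splits)
      then show "j \<in> {s * c..<s * c + s}"
        using assms(1) dividend_less_times_div[of s j] by auto
    next
      fix j assume j: "j \<in> {s * c..<s * c + s}"
      then have "j div s = c" by (intro div_nat_eqI) (auto simp: mult.commute)
      then show "j \<in> {j. j < ?N \<and> b j = b i}" using j le True by (auto simp: b_def c_def)
    qed
    then show ?thesis by simp
  next
    case False
    define c where "c = (i - s * x) div t"
    have "c < y" using False i by (simp add: c_def less_mult_imp_div_less mult.commute)
    then have le: "t * c + t \<le> t * y" by (metis Suc_leI mult_Suc_right mult_le_mono2 add.commute)
    have low: "j div s < x" if "j < s * x" for j
      using that by (simp add: less_mult_imp_div_less mult.commute)
    have "{j. j < ?N \<and> b j = b i} = {s * x + t * c..<s * x + t * c + t}"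
    proof (intro equalityI subsetI)
      fix j assume "j \<in> {j. j < ?N \<and> b j = b i}"
      then have j: "j \<ge> s * x" "(j - s * x) div t = c"
        using False low[of j] by (auto simp: b_def c_def split: if_splits)
      have "t * c \<le> j - s * x" unfolding j(2)[symmetric] by simp
      moreover have "j - s * x < t * c + t"
        using dividend_less_times_div[OF assms(2), of "j - s * x"] j(2) by simp
      ultimately show "j \<in> {s * x + t * c..<s * x + t * c + t}" using j(1) by auto
    next
      fix j assume j: "j \<in> {s * x + t * c..<s * x + t * c + t}"
      then have "(j - s * x) div t = c" by (intro div_nat_eqI) (auto simp: mult.commute)
      then show "j \<in> {j. j < ?N \<and> b j = b i}" using j le False by (auto simp: b_def c_def)
    qed
    then show ?thesis by simp
  qed
  then show ?thesis using that by blast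
qed

text \<open>Write \<open>N = t * q + r\<close>. The bound on \<open>N\<close> gives
  \<open>q \<ge> t - 1 \<ge> r\<close>, so there are enough parts of size \<open>t\<close> to
  enlarge \<open>r\<close> of them by one and absorb the remainder.\<close>

lemma consecutive_representation:
  fixes N t :: nat
  assumes "N \<ge> t * (t - 1)" "t > 0"
  obtains x y where "N = (t + 1) * x + t * y"
proof -
  define q r where "q = N div t" and "r = N mod t"
  have N: "N = t * q + r" and r: "r < t" using assms by (auto simp: q_def r_def)
  have "t - 1 \<le> q" using assms by (simp add: q_def less_eq_div_iff_mult_less_eq mult.commute)
  then have "r \<le> q" using r by linarith
  then obtain y where "q = r + y" using le_Suc_ex by blast
  then have "N = (t + 1) * r + t * y" using N by (simp add: algebra_simps)
  then show ?thesis using that by blast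
qed

text \<open>Treats both cases of the theorem at once, with clusters of sizes \<open>m - 1\<close>
  and \<open>t\<close> on \<open>N - 1\<close> vertices. The bound \<open>t \<le> m - 1\<close>
  keeps \<open>star3\<close> out of the graph; the last bound leaves at most \<open>n - 3\<close>
  vertices outside any cluster, which keeps the near-stars out of the complement.\<close>

lemma ramsey_number_near_stars:
  assumes m: "m \<ge> 10" "{p, q, r} \<subseteq> {1..m-4}" and n: "n > m" and T': "is_T' n T'"
    and N: "N \<ge> m + n - 4" "N \<ge> m + n - 3 \<or> \<not> m - 1 dvd N"
    and rep: "N - 1 = (m - 1) * x + t * y" "t > 0" "t \<le> m - 1" "N - 1 - (n - 3) \<le> t"
  shows "ramsey_number (star3 m p q r) T' = N" "ramsey_number (star3 m p q r) (T_star n) = N"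
proof -
  obtain b :: "nat \<Rightarrow> nat" where b: "\<And>i. i < N - 1 \<Longrightarrow> card {j. j < N - 1 \<and> b j = b i} \<in> {m - 1, t}"
    using exists_clustering[of "m - 1" t x y] m(1) rep by auto
  have small: "card {j. j < N - 1 \<and> b j = b i} \<le> m - 1"
    and large: "N - 1 - (n - 3) \<le> card {j. j < N - 1 \<and> b j = b i}" if "i < N - 1" for i
    using b[OF that] rep by auto
  have m5: "m \<ge> 5" and n4: "n \<ge> 4" and n3: "n \<ge> 3" and N0: "N > 0" using m n N by auto
  have cG: "simple_graph (cluster_graph b M)" "card (verts (cluster_graph b M)) = M" for M
    using simple_graph_cluster_graph by (auto simp: cluster_graph_def)
  show "ramsey_number (star3 m p q r) T' = N"
  proof (rule ramsey_number_eqI[OF N0])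
    fix G :: "nat ugraph" assume G: "simple_graph G" "card (verts G) = N"
    note H = simple_graph_complement[OF G(1)]
    show "contains_copy G (star3 m p q r) \<or> contains_copy (complement G) T'"
    proof (rule star3_or_near_star[OF G(1) m n])
      show "contains_copy (complement G) T'"
        if "u \<in> nbrs (complement G) v" "w \<noteq> v" "u \<in> nbrs (complement G) w"
          "card (nbrs (complement G) v - {w}) \<ge> n - 2" for v w u
        using contains_copy_T'I[OF H T' n3 that(1) _ that(2,4)] that(3) nbrs_sym by metis
    qed (use G N in auto)
  next
    fix M assume "M < N"
    then have M: "M \<le> N - 1" by simp
    show "\<exists>G :: nat ugraph. simple_graph G \<and> card (verts G) = M \<and>
        \<not> contains_copy G (star3 m p q r) \<and> \<not> contains_copy (complement G) T'"
      using cG cluster_graph_no_star3[OF m5 m(2) M small]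
        cluster_graph_complement_no_T'[OF T' n3 M large] by blast
  qed
  show "ramsey_number (star3 m p q r) (T_star n) = N"
  proof (rule ramsey_number_eqI[OF N0])
    fix G :: "nat ugraph" assume G: "simple_graph G" "card (verts G) = N"
    note H = simple_graph_complement[OF G(1)]
    show "contains_copy G (star3 m p q r) \<or> contains_copy (complement G) (T_star n)"
    proof (rule star3_or_near_star[OF G(1) m n])
      fix v w x y
      assume xy: "x \<in> nbrs (complement G) v" "y \<in> nbrs (complement G) v" "x \<noteq> y" "w \<noteq> v"
        "x \<in> nbrs (complement G) w" "y \<in> nbrs (complement G) w"
        "card (nbrs (complement G) v - {w}) \<ge> n - 2"
      \<comment> \<open>The tail is placed on the path \<open>v\<close>, \<open>x\<close>,
        \<open>w\<close>, \<open>y\<close>. Its end \<open>y\<close> is itself a neighbour of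
        \<open>v\<close>, so it costs one leaf and turns \<open>n - 2\<close> into
        \<open>n - 3\<close>.\<close>
      have "nbrs (complement G) v - {w, y} = nbrs (complement G) v - {w} - {y}" by auto
      then have "card (nbrs (complement G) v - {w, y}) \<ge> n - 3"
        using xy(7) diff_card_le_card_Diff[of "{y}" "nbrs (complement G) v - {w}"] by simp
      moreover have "y \<noteq> v" using xy(2) nbrs_subset[OF H] by blast
      ultimately show "contains_copy (complement G) (T_star n)"
        using contains_copy_T_starI[OF H n4 xy(1) _ xy(6) xy(4)] xy(3,5) nbrs_sym by metis
    qed (use G N in auto)
  next
    fix M assume "M < N"
    then have M: "M \<le> N - 1" by simp
    show "\<exists>G :: nat ugraph. simple_graph G \<and> card (verts G) = M \<and>
        \<not> contains_copy G (star3 m p q r) \<and> \<not> contains_copy (complement G) (T_star n)"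
      using cG cluster_graph_no_star3[OF m5 m(2) M small]
        cluster_graph_complement_no_T_star[OF n4 M large] by blast
  qed
qed

section \<open>The two cases of the theorem\<close>

theorem theorem5p4:
  fixes m n :: nat and T :: "nat ugraph" and T' :: "'a ugraph"
  assumes "m \<ge> 10" and "n > m"
    and "T \<in> {T_2 m, T_3 m, T_cube m}"
    and "is_T' n T'"
  shows "(m - 1 dvd n - 3 \<longrightarrow>
            ramsey_number T T' = m + n - 3 \<and> ramsey_number T (T_star n) = m + n - 3) \<and>
         (\<not> m - 1 dvd n - 3 \<and> n \<ge> (m - 3)\<^sup>2 + 2 \<longrightarrow>
            ramsey_number T T' = m + n - 4 \<and> ramsey_number T (T_star n) = m + n - 4)"
proof -
  have "T_2 m = star3 m 1 1 2" "T_3 m = star3 m 1 2 3" "T_cube m = star3 m (m-4) (m-4) (m-4)"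
    by (simp_all add: T_2_def T_3_def T_cube_def star3_def)
  moreover have "{1, 1, 2} \<subseteq> {1..m-4}" "{1, 2, 3} \<subseteq> {1..m-4}" "{m-4, m-4, m-4} \<subseteq> {1..m-4}"
    using assms(1) by auto
  ultimately obtain p q r where T: "T = star3 m p q r" and pqr: "{p, q, r} \<subseteq> {1..m-4}"
    using assms(3) by (metis empty_iff insert_iff)
  note main = ramsey_number_near_stars[OF assms(1) pqr assms(2,4), folded T]
  have dvd: "m - 1 dvd m + n - 4 \<longleftrightarrow> m - 1 dvd n - 3"
  proof -
    have "m + n - 4 = (m - 1) + (n - 3)" using assms(1,2) by linarith
    then show ?thesis by (metis dvd_add_right_iff dvd_refl)
  qed
  show ?thesis
  proof (intro conjI impI; (elim conjE)?)
    assume "m - 1 dvd n - 3"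
    then obtain x where x: "m + n - 4 = (m - 1) * x" using dvd by blast
    \<comment> \<open>All clusters have size \<open>m - 1\<close>: here \<open>t = m - 1\<close> and
      \<open>y = 0\<close>, and \<open>N - 1 - (n - 3)\<close> is exactly \<open>t\<close>.\<close>
    have "m + n - 3 - 1 = (m - 1) * x + (m - 1) * 0" using x assms by simp
    from main[OF _ _ this]
    show "ramsey_number T T' = m + n - 3" "ramsey_number T (T_star n) = m + n - 3"
      using assms(1,2) by auto
  next
    assume nd: "\<not> m - 1 dvd n - 3" and large: "n \<ge> (m - 3)\<^sup>2 + 2"
    \<comment> \<open>With \<open>k = m - 3\<close> the condition for cluster sizes
      \<open>m - 1\<close> and \<open>t = m - 2\<close> reads
      \<open>k + (n - 2) \<ge> k * k + k\<close>, which is \<open>n \<ge> k * k + 2\<close>.\<close>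
    obtain k where k: "m = k + 3" using assms(1) le_Suc_ex[of 3 m] by (auto simp: add.commute)
    have "(m - 2) * (m - 2 - 1) = k * k + k" by (simp add: k algebra_simps)
    moreover have "k * k + 2 \<le> n" using large by (simp add: k power2_eq_square)
    ultimately have "m + n - 5 \<ge> (m - 2) * (m - 2 - 1)" using k by linarith
    then obtain x y where "m + n - 5 = (m - 2 + 1) * x + (m - 2) * y"
      using consecutive_representation[of "m - 2"] assms(1) by auto
    moreover have "m - 2 + 1 = m - 1" "m + n - 4 - 1 = m + n - 5" using assms(1) by auto
    ultimately have "m + n - 4 - 1 = (m - 1) * x + (m - 2) * y" by metis
    from main[OF _ _ this]
    show "ramsey_number T T' = m + n - 4" "ramsey_number T (T_star n) = m + n - 4"
      using nd dvd assms(1,2) by auto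
  qed
qed

end
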